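(* Let $(\mathcal{A};\mathcal{WE})$ be a weak exact category. If $(\mathcal{I}_1,\mathcal{J}_1)$ and $(\mathcal{I}_2,\mathcal{J}_2)$ are two complete ideal torsion pairs in $(\mathcal{A};\mathcal{WE})$, then so are $(\mathcal{I}_1\mathcal{I}_2,\ \mathcal{J}_2\diamond\mathcal{J}_1)$ and $(\mathcal{I}_1\diamond\mathcal{I}_2,\ \mathcal{J}_2\mathcal{J}_1)$.
   Context: Additive categories have finite coproducts. An ideal of an additive category $\mathcal{A}$ is an additive subbifunctor of $\mathrm{Hom}(-,-)$. For a collection $\mathcal{M}$ of morphisms, $\mathcal{M}^{\perp}$ is the ideal of all $j$ with $jxf=0$ for every $f\in\mathcal{M}$ and every morphism $x$ from the codomain of $f$ to the domain of $j$; ${}^{\perp}\mathcal{M}$ is the ideal of all $i$ with $fxi=0$ for every $f\in\mathcal{M}$ and every $x$ from the codomain of $i$ to the domain of $f$. A pair $(\mathcal{I},\mathcal{J})$ of ideals is an ideal torsion pair if $\mathcal{I}={}^{\perp}\mathcal{J}$ and $\mathcal{J}=\mathcal{I}^{\perp}$. The product $\mathcal{I}_1\mathcal{I}_2$ of ideals is the ideal $\{i_1i_2\mid i_1\in\mathcal{I}_1,\ i_2\in\mathcal{I}_2,\text{ composable}\}$. A weak kernel of $g\colon Y\to Z$ is a morphism $k\colon X\to Y$ with $gk=0$ such that every $k'$ with $gk'=0$ factors (not necessarily uniquely) through $k$; weak cokernels are dual. A weak kernel-cokernel pair is a composable pair $X\xrightarrow{k}Y\xrightarrow{c}Z$ with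 $k$ a weak kernel of $c$ and $c$ a weak cokernel of $k$; these form an additive category with morphisms the commutative ladders. A weak kernel-cokernel category is an additive category $\mathcal{A}$ with a collection of weak kernel-cokernel pairs (called weak conflations) forming an additive subcategory (in particular closed under finite coproducts) closed under isomorphism and containing $A\xrightarrow{1_A}A\to0$ and $0\to A\xrightarrow{1_A}A$ for all $A$. In a weak conflation $(k,c)$, $k$ is called a weak inflation and $c$ a weak deflation. A weak exact category $(\mathcal{A};\mathcal{WE})$ is a weak kernel-cokernel category such that weak inflations are closed under composition, weak deflations are closed under composition, and (Five Lemma) for every commutative ladder $(f,g,h)$ between two weak conflations, if two of $f,g,h$ are isomorphisms then so is the third. A morphism $e\colon F\to T$ is a weak extension $e=i\star j$ of $j$ by $i$ if there are a weak conflation $X\xrightarrow{k}Y\xrightarrow{c}Z$ and morphisms $e^2\colon F\to Y$, $e^1\colon Y\to T$ with $e=e^1e^2$, $ce^2=j$ and $e^1k=i$. For ideals $\mathcal{I},\mathcal{J}$, $\mathcal{I}\diamond\mathcal{J}$ is the ideal of all weak extensions $i\star j$ with $i\in\mathcal{I}$, $j\in\mathcal{J}$. An $\mathcal{I}$-precover of $X$ is a morphism $T\to X$ in $\mathcal{I}$ through which every morphism in $\mathcal{I}$ with codomain $X$ factors; it is Hom-special if it is a weak inflation. $\mathcal{J}$-preenvelopes are dual, and are Hom-special if they are weak deflations. $\mathcal{I}$ is Hom-special precovering (resp. $\mathcal{J}$ is Hom-special preenveloping) if every object has a Hom-special $\mathcal{I}$-precover (resp. $\mathcal{J}$-preenvelope).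 An ideal torsion pair $(\mathcal{I},\mathcal{J})$ is complete if $\mathcal{I}$ is Hom-special precovering, equivalently $\mathcal{J}$ is Hom-special preenveloping. *)

theory Defs
  imports "HOL-Algebra.Group"
begin

record ('o, 'm) cat =
  Obj :: "'o set"
  Arr :: "'m set"
  Dom :: "'m \<Rightarrow> 'o"
  Cod :: "'m \<Rightarrow> 'o"
  Ident :: "'o \<Rightarrow> 'm"
  Comp :: "'m \<Rightarrow> 'm \<Rightarrow> 'm"  (infixr "\<cdot>\<index>" 70)

definition Hom :: "('o, 'm, 'z) cat_scheme \<Rightarrow> 'o \<Rightarrow> 'o \<Rightarrow> 'm set" where
  "Hom C X Y = {f \<in> Arr C. Dom C f = X \<and> Cod C f = Y}"

locale category =
  fixes C :: "('o, 'm, 'z) cat_scheme" (structure)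
  assumes Dom_Obj: "f \<in> Arr C \<Longrightarrow> Dom C f \<in> Obj C"
    and Cod_Obj: "f \<in> Arr C \<Longrightarrow> Cod C f \<in> Obj C"
    and Ident_Hom: "X \<in> Obj C \<Longrightarrow> Ident C X \<in> Hom C X X"
    and Comp_Hom: "\<lbrakk>f \<in> Hom C X Y; g \<in> Hom C Y Z\<rbrakk> \<Longrightarrow> g \<cdot> f \<in> Hom C X Z"
    and Comp_assoc: "\<lbrakk>f \<in> Hom C W X; g \<in> Hom C X Y; h \<in> Hom C Y Z\<rbrakk>
                      \<Longrightarrow> (h \<cdot> g) \<cdot> f = h \<cdot> (g \<cdot> f)"
    and Comp_Ident_right: "f \<in> Hom C X Y \<Longrightarrow> f \<cdot> Ident C X = f"
    and Comp_Ident_left: "f \<in> Hom C X Y \<Longrightarrow> Ident C Y \<cdot> f = f"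

definition is_iso :: "('o, 'm, 'z) cat_scheme \<Rightarrow> 'm \<Rightarrow> bool" where
  "is_iso C f \<longleftrightarrow> f \<in> Arr C \<and>
     (\<exists>g \<in> Hom C (Cod C f) (Dom C f).
        g \<cdot>\<^bsub>C\<^esub> f = Ident C (Dom C f) \<and> f \<cdot>\<^bsub>C\<^esub> g = Ident C (Cod C f))"

definition isomorphic :: "('o, 'm, 'z) cat_scheme \<Rightarrow> 'o \<Rightarrow> 'o \<Rightarrow> bool" where
  "isomorphic C X Y \<longleftrightarrow> (\<exists>f \<in> Hom C X Y. is_iso C f)"

definition initial_object :: "('o, 'm, 'z) cat_scheme \<Rightarrow> 'o \<Rightarrow> bool" where
  "initial_object C Z \<longleftrightarrow> Z \<in> Obj C \<and> (\<forall>X \<in> Obj C. \<exists>!f. f \<in> Hom C Z X)"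

definition terminal_object :: "('o, 'm, 'z) cat_scheme \<Rightarrow> 'o \<Rightarrow> bool" where
  "terminal_object C Z \<longleftrightarrow> Z \<in> Obj C \<and> (\<forall>X \<in> Obj C. \<exists>!f. f \<in> Hom C X Z)"

definition zero_object :: "('o, 'm, 'z) cat_scheme \<Rightarrow> 'o \<Rightarrow> bool" where
  "zero_object C Z \<longleftrightarrow> initial_object C Z \<and> terminal_object C Z"

definition is_coproduct ::
    "('o, 'm, 'z) cat_scheme \<Rightarrow> 'o \<Rightarrow> 'o \<Rightarrow> 'o \<Rightarrow> 'm \<Rightarrow> 'm \<Rightarrow> bool" where
  "is_coproduct C X Y S u v \<longleftrightarrow> S \<in> Obj C \<and> u \<in> Hom C X S \<and> v \<in> Hom C Y S \<and>
     (\<forall>Z \<in> Obj C. \<forall>f \<in> Hom C X Z. \<forall>g \<in> Hom C Y Z.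
        \<exists>!h. h \<in> Hom C S Z \<and> h \<cdot>\<^bsub>C\<^esub> u = f \<and> h \<cdot>\<^bsub>C\<^esub> v = g)"

text \<open>Finite coproducts are treated as the empty one (an initial object) together with the
  binary ones.\<close>

definition has_finite_coproducts :: "('o, 'm, 'z) cat_scheme \<Rightarrow> bool" where
  "has_finite_coproducts C \<longleftrightarrow> (\<exists>Z. initial_object C Z) \<and>
     (\<forall>X \<in> Obj C. \<forall>Y \<in> Obj C. \<exists>S u v. is_coproduct C X Y S u v)"

definition closed_under_finite_coproducts :: "('o, 'm, 'z) cat_scheme \<Rightarrow> 'o set \<Rightarrow> bool" where
  "closed_under_finite_coproducts C \<S> \<longleftrightarrow> (\<forall>Z. initial_object C Z \<longrightarrow> Z \<in> \<S>) \<and>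
     (\<forall>X \<in> \<S>. \<forall>Y \<in> \<S>. \<forall>S u v. is_coproduct C X Y S u v \<longrightarrow> S \<in> \<S>)"

definition closed_under_isomorphism :: "('o, 'm, 'z) cat_scheme \<Rightarrow> 'o set \<Rightarrow> bool" where
  "closed_under_isomorphism C \<S> \<longleftrightarrow> (\<forall>X \<in> \<S>. \<forall>Y. isomorphic C X Y \<longrightarrow> Y \<in> \<S>)"

record ('o, 'm) preadd_cat = "('o, 'm) cat" +
  Add :: "'m \<Rightarrow> 'm \<Rightarrow> 'm"
  Zero :: "'o \<Rightarrow> 'o \<Rightarrow> 'm"

definition Hom_group :: "('o, 'm, 'z) preadd_cat_scheme \<Rightarrow> 'o \<Rightarrow> 'o \<Rightarrow> 'm monoid" where
  "Hom_group A X Y = \<lparr>carrier = Hom A X Y, monoid.mult = Add A, one = Zero A X Y\<rparr>"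

locale preadditive_category = category A for A :: "('o, 'm, 'z) preadd_cat_scheme" (structure) +
  assumes Hom_comm_group: "\<lbrakk>X \<in> Obj A; Y \<in> Obj A\<rbrakk> \<Longrightarrow> comm_group (Hom_group A X Y)"
    and Comp_Add_left: "\<lbrakk>f \<in> Hom A X Y; g \<in> Hom A Y Z; g' \<in> Hom A Y Z\<rbrakk>
                         \<Longrightarrow> Add A g g' \<cdot> f = Add A (g \<cdot> f) (g' \<cdot> f)"
    and Comp_Add_right: "\<lbrakk>f \<in> Hom A X Y; f' \<in> Hom A X Y; g \<in> Hom A Y Z\<rbrakk>
                          \<Longrightarrow> g \<cdot> Add A f f' = Add A (g \<cdot> f) (g \<cdot> f')"

locale additive_category = preadditive_category +
  assumes finite_coproducts: "has_finite_coproducts A"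

text \<open>Ideals are represented by the set of all their morphisms; since every morphism has a
  unique domain and codomain, the value at \<open>(X, Y)\<close> of the corresponding subbifunctor is the
  intersection with \<open>Hom A X Y\<close>.\<close>

definition ideal :: "('o, 'm, 'z) preadd_cat_scheme \<Rightarrow> 'm set \<Rightarrow> bool" where
  "ideal A \<I> \<longleftrightarrow> \<I> \<subseteq> Arr A \<and>
     (\<forall>X \<in> Obj A. \<forall>Y \<in> Obj A. subgroup (\<I> \<inter> Hom A X Y) (Hom_group A X Y)) \<and>
     (\<forall>i \<in> \<I>. \<forall>f \<in> Arr A. Cod A f = Dom A i \<longrightarrow> i \<cdot>\<^bsub>A\<^esub> f \<in> \<I>) \<and>
     (\<forall>i \<in> \<I>. \<forall>f \<in> Arr A. Cod A i = Dom A f \<longrightarrow> f \<cdot>\<^bsub>A\<^esub> i \<in> \<I>)"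

definition right_perp :: "('o, 'm, 'z) preadd_cat_scheme \<Rightarrow> 'm set \<Rightarrow> 'm set" where
  "right_perp A \<M> = {j \<in> Arr A. \<forall>f \<in> \<M>. \<forall>x \<in> Hom A (Cod A f) (Dom A j).
     j \<cdot>\<^bsub>A\<^esub> x \<cdot>\<^bsub>A\<^esub> f = Zero A (Dom A f) (Cod A j)}"

definition left_perp :: "('o, 'm, 'z) preadd_cat_scheme \<Rightarrow> 'm set \<Rightarrow> 'm set" where
  "left_perp A \<M> = {i \<in> Arr A. \<forall>f \<in> \<M>. \<forall>x \<in> Hom A (Cod A i) (Dom A f).
     f \<cdot>\<^bsub>A\<^esub> x \<cdot>\<^bsub>A\<^esub> i = Zero A (Dom A i) (Cod A f)}"

definition ideal_torsion_pair ::
    "('o, 'm, 'z) preadd_cat_scheme \<Rightarrow> 'm set \<Rightarrow> 'm set \<Rightarrow> bool" where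
  "ideal_torsion_pair A \<I> \<J> \<longleftrightarrow>
     ideal A \<I> \<and> ideal A \<J> \<and> \<I> = left_perp A \<J> \<and> \<J> = right_perp A \<I>"

definition ideal_product ::
    "('o, 'm, 'z) preadd_cat_scheme \<Rightarrow> 'm set \<Rightarrow> 'm set \<Rightarrow> 'm set" where
  "ideal_product A \<I> \<J> = {i \<cdot>\<^bsub>A\<^esub> j | i j. i \<in> \<I> \<and> j \<in> \<J> \<and> Dom A i = Cod A j}"

definition weak_kernel :: "('o, 'm, 'z) preadd_cat_scheme \<Rightarrow> 'm \<Rightarrow> 'm \<Rightarrow> bool" where
  "weak_kernel A k g \<longleftrightarrow> k \<in> Arr A \<and> g \<in> Arr A \<and> Cod A k = Dom A g \<and>
     g \<cdot>\<^bsub>A\<^esub> k = Zero A (Dom A k) (Cod A g) \<and>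
     (\<forall>k' \<in> Arr A. Cod A k' = Dom A g \<and> g \<cdot>\<^bsub>A\<^esub> k' = Zero A (Dom A k') (Cod A g) \<longrightarrow>
        (\<exists>h \<in> Hom A (Dom A k') (Dom A k). k' = k \<cdot>\<^bsub>A\<^esub> h))"

definition weak_cokernel :: "('o, 'm, 'z) preadd_cat_scheme \<Rightarrow> 'm \<Rightarrow> 'm \<Rightarrow> bool" where
  "weak_cokernel A c g \<longleftrightarrow> c \<in> Arr A \<and> g \<in> Arr A \<and> Cod A g = Dom A c \<and>
     c \<cdot>\<^bsub>A\<^esub> g = Zero A (Dom A g) (Cod A c) \<and>
     (\<forall>c' \<in> Arr A. Dom A c' = Cod A g \<and> c' \<cdot>\<^bsub>A\<^esub> g = Zero A (Dom A g) (Cod A c') \<longrightarrow>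
        (\<exists>h \<in> Hom A (Cod A c) (Cod A c'). c' = h \<cdot>\<^bsub>A\<^esub> c))"

definition weak_kc_pair :: "('o, 'm, 'z) preadd_cat_scheme \<Rightarrow> 'm \<times> 'm \<Rightarrow> bool" where
  "weak_kc_pair A = (\<lambda>(k, c). weak_kernel A k c \<and> weak_cokernel A c k)"

definition ladder :: "('o, 'm, 'z) preadd_cat_scheme
    \<Rightarrow> 'm \<times> 'm \<Rightarrow> 'm \<times> 'm \<Rightarrow> 'm \<times> 'm \<times> 'm \<Rightarrow> bool" where
  "ladder A = (\<lambda>(k, c) (k', c') (f, g, h).
     f \<in> Hom A (Dom A k) (Dom A k') \<and>
     g \<in> Hom A (Cod A k) (Cod A k') \<and>
     h \<in> Hom A (Cod A c) (Cod A c') \<and>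
     g \<cdot>\<^bsub>A\<^esub> k = k' \<cdot>\<^bsub>A\<^esub> f \<and> h \<cdot>\<^bsub>A\<^esub> c = c' \<cdot>\<^bsub>A\<^esub> g)"

text \<open>In the category of weak kernel-cokernel pairs, a morphism is a triple \<open>(p, (f, g, h), q)\<close>
  carrying its domain \<open>p\<close> and codomain \<open>q\<close> along with the commutative ladder.\<close>

definition weak_kc_pair_cat :: "('o, 'm, 'z) preadd_cat_scheme
    \<Rightarrow> ('m \<times> 'm, ('m \<times> 'm) \<times> ('m \<times> 'm \<times> 'm) \<times> ('m \<times> 'm)) cat" where
  "weak_kc_pair_cat A = \<lparr>
     Obj = {p. weak_kc_pair A p},
     Arr = {(p, t, q). weak_kc_pair A p \<and> weak_kc_pair A q \<and> ladder A p q t},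
     Dom = (\<lambda>(p, t, q). p),
     Cod = (\<lambda>(p, t, q). q),
     Ident = (\<lambda>(k, c). ((k, c), (Ident A (Dom A k), Ident A (Cod A k), Ident A (Cod A c)), (k, c))),
     Comp = (\<lambda>(q', (f', g', h'), r) (p, (f, g, h), q).
       (p, (f' \<cdot>\<^bsub>A\<^esub> f, g' \<cdot>\<^bsub>A\<^esub> g, h' \<cdot>\<^bsub>A\<^esub> h), r))\<rparr>"

locale weak_kc_category = additive_category A
  for A :: "('o, 'm, 'z) preadd_cat_scheme" (structure) and WE :: "('m \<times> 'm) set" +
  assumes WE_pairs: "WE \<subseteq> Obj (weak_kc_pair_cat A)"
    and WE_coproducts: "closed_under_finite_coproducts (weak_kc_pair_cat A) WE"
    and WE_iso: "closed_under_isomorphism (weak_kc_pair_cat A) WE"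
    and WE_right_trivial: "\<lbrakk>X \<in> Obj A; zero_object A Z\<rbrakk> \<Longrightarrow> (Ident A X, Zero A X Z) \<in> WE"
    and WE_left_trivial: "\<lbrakk>X \<in> Obj A; zero_object A Z\<rbrakk> \<Longrightarrow> (Zero A Z X, Ident A X) \<in> WE"

definition weak_inflation :: "('m \<times> 'm) set \<Rightarrow> 'm \<Rightarrow> bool" where
  "weak_inflation WE k \<longleftrightarrow> (\<exists>c. (k, c) \<in> WE)"

definition weak_deflation :: "('m \<times> 'm) set \<Rightarrow> 'm \<Rightarrow> bool" where
  "weak_deflation WE c \<longleftrightarrow> (\<exists>k. (k, c) \<in> WE)"

locale weak_exact_category = weak_kc_category +
  assumes weak_inflation_Comp:
      "\<lbrakk>weak_inflation WE k; weak_inflation WE k'; Cod A k = Dom A k'\<rbrakk>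
        \<Longrightarrow> weak_inflation WE (k' \<cdot> k)"
    and weak_deflation_Comp:
      "\<lbrakk>weak_deflation WE c; weak_deflation WE c'; Cod A c = Dom A c'\<rbrakk>
        \<Longrightarrow> weak_deflation WE (c' \<cdot> c)"
    and five_lemma:
      "\<lbrakk>p \<in> WE; q \<in> WE; ladder A p q (f, g, h);
        is_iso A f \<and> is_iso A g \<or> is_iso A f \<and> is_iso A h \<or> is_iso A g \<and> is_iso A h\<rbrakk>
        \<Longrightarrow> is_iso A f \<and> is_iso A g \<and> is_iso A h"

definition is_weak_extension ::
    "('o, 'm, 'z) preadd_cat_scheme \<Rightarrow> ('m \<times> 'm) set \<Rightarrow> 'm \<Rightarrow> 'm \<Rightarrow> 'm \<Rightarrow> bool" where
  "is_weak_extension A WE e i j \<longleftrightarrow> e \<in> Arr A \<and>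
     (\<exists>k c e1 e2. (k, c) \<in> WE \<and>
        e2 \<in> Hom A (Dom A e) (Cod A k) \<and> e1 \<in> Hom A (Cod A k) (Cod A e) \<and>
        e = e1 \<cdot>\<^bsub>A\<^esub> e2 \<and> c \<cdot>\<^bsub>A\<^esub> e2 = j \<and> e1 \<cdot>\<^bsub>A\<^esub> k = i)"

definition ideal_diamond :: "('o, 'm, 'z) preadd_cat_scheme
    \<Rightarrow> ('m \<times> 'm) set \<Rightarrow> 'm set \<Rightarrow> 'm set \<Rightarrow> 'm set" where
  "ideal_diamond A WE \<I> \<J> = {e. \<exists>i \<in> \<I>. \<exists>j \<in> \<J>. is_weak_extension A WE e i j}"

definition precover :: "('o, 'm, 'z) preadd_cat_scheme \<Rightarrow> 'm set \<Rightarrow> 'o \<Rightarrow> 'm \<Rightarrow> bool" where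
  "precover A \<I> X i \<longleftrightarrow> i \<in> \<I> \<and> Cod A i = X \<and>
     (\<forall>f \<in> \<I>. Cod A f = X \<longrightarrow> (\<exists>h \<in> Hom A (Dom A f) (Dom A i). f = i \<cdot>\<^bsub>A\<^esub> h))"

definition preenvelope :: "('o, 'm, 'z) preadd_cat_scheme \<Rightarrow> 'm set \<Rightarrow> 'o \<Rightarrow> 'm \<Rightarrow> bool" where
  "preenvelope A \<J> X j \<longleftrightarrow> j \<in> \<J> \<and> Dom A j = X \<and>
     (\<forall>f \<in> \<J>. Dom A f = X \<longrightarrow> (\<exists>h \<in> Hom A (Cod A j) (Cod A f). f = h \<cdot>\<^bsub>A\<^esub> j))"

definition Hom_special_precovering ::
    "('o, 'm, 'z) preadd_cat_scheme \<Rightarrow> ('m \<times> 'm) set \<Rightarrow> 'm set \<Rightarrow> bool" where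
  "Hom_special_precovering A WE \<I> \<longleftrightarrow>
     (\<forall>X \<in> Obj A. \<exists>i. precover A \<I> X i \<and> weak_inflation WE i)"

definition Hom_special_preenveloping ::
    "('o, 'm, 'z) preadd_cat_scheme \<Rightarrow> ('m \<times> 'm) set \<Rightarrow> 'm set \<Rightarrow> bool" where
  "Hom_special_preenveloping A WE \<J> \<longleftrightarrow>
     (\<forall>X \<in> Obj A. \<exists>j. preenvelope A \<J> X j \<and> weak_deflation WE j)"

definition complete_ideal_torsion_pair ::
    "('o, 'm, 'z) preadd_cat_scheme \<Rightarrow> ('m \<times> 'm) set \<Rightarrow> 'm set \<Rightarrow> 'm set \<Rightarrow> bool" where
  "complete_ideal_torsion_pair A WE \<I> \<J> \<longleftrightarrow>
     ideal_torsion_pair A \<I> \<J> \<and> Hom_special_precovering A WE \<I>"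

text \<open>Completeness is defined on the precovering side; the lemma
  \<open>complete_ideal_torsion_pair_iff_preenveloping\<close> below shows that the preenveloping side
  gives the same notion.\<close>

context weak_kc_category
begin

lemma WE_D:
  assumes "(k, c) \<in> WE"
  shows "weak_kernel A k c" "weak_cokernel A c k"
  using assms WE_pairs by (auto simp: weak_kc_pair_cat_def weak_kc_pair_def)

lemma complete_ideal_torsion_pair_iff_preenveloping:
  "complete_ideal_torsion_pair A WE \<I> \<J> \<longleftrightarrow>
     ideal_torsion_pair A \<I> \<J> \<and> Hom_special_preenveloping A WE \<J>"
proof (cases "ideal_torsion_pair A \<I> \<J>")
  case tp: True
  then have I: "\<I> = left_perp A \<J>" and J: "\<J> = right_perp A \<I>"
    and idI: "ideal A \<I>" and idJ: "ideal A \<J>"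
    unfolding ideal_torsion_pair_def by blast+
  have ortho: "j \<cdot> i = Zero A (Dom A i) (Cod A j)"
    if "i \<in> \<I>" "j \<in> \<J>" "Cod A i = Dom A j" for i j
  proof -
    have i: "i \<in> Hom A (Dom A i) (Cod A i)" using that idI unfolding ideal_def Hom_def by blast
    then have "Ident A (Cod A i) \<in> Hom A (Cod A i) (Dom A j)"
      using Ident_Hom[OF Cod_Obj, of i] that by (simp add: Hom_def)
    then have "j \<cdot> Ident A (Cod A i) \<cdot> i = Zero A (Dom A i) (Cod A j)"
      using that J by (auto simp: right_perp_def)
    then show ?thesis using Comp_Ident_left[OF i] by simp
  qed
  have "Hom_special_preenveloping A WE \<J>" if sp: "Hom_special_precovering A WE \<I>"
    unfolding Hom_special_preenveloping_def
  proof
    fix X assume "X \<in> Obj A"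
    then obtain i c where i: "precover A \<I> X i" and ic: "(i, c) \<in> WE"
      using sp by (auto simp: Hom_special_precovering_def weak_inflation_def)
    have c: "c \<in> \<J>"
      unfolding J right_perp_def
    proof (intro CollectI conjI ballI)
      show cA: "c \<in> Arr A" using WE_D[OF ic] unfolding weak_kernel_def by blast
      fix f x assume f: "f \<in> \<I>" and x: "x \<in> Hom A (Cod A f) (Dom A c)"
      have iX: "Dom A c = X" "Cod A i = X" using i WE_D[OF ic] unfolding weak_kernel_def precover_def by simp_all
      have fh: "f \<in> Hom A (Dom A f) (Cod A f)" using f idI unfolding ideal_def Hom_def by blast
      have "x \<cdot> f \<in> \<I>" using f x idI unfolding ideal_def Hom_def by (metis (lifting) mem_Collect_eq)
      moreover have xf: "x \<cdot> f \<in> Hom A (Dom A f) X" using Comp_Hom[OF fh x] iX by simp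
      moreover from xf have "Dom A (x \<cdot> f) = Dom A f" "Cod A (x \<cdot> f) = X"
        by (simp_all add: Hom_def)
      ultimately obtain h where h: "h \<in> Hom A (Dom A f) (Dom A i)" "x \<cdot> f = i \<cdot> h"
        using i unfolding precover_def by metis
      have ih: "i \<in> Hom A (Dom A i) X" "c \<in> Hom A X (Cod A c)"
        using iX WE_D[OF ic] unfolding weak_kernel_def Hom_def by simp_all
      have O: "Dom A i \<in> Obj A" "Cod A c \<in> Obj A" "Dom A f \<in> Obj A"
        using ih fh Dom_Obj Cod_Obj by (auto simp: Hom_def)
      have z: "Zero A (Dom A i) (Cod A c) \<cdot> h = Zero A (Dom A f) (Cod A c)"
      proof -
        interpret G: comm_group "Hom_group A (Dom A i) (Cod A c)" using Hom_comm_group O by simp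
        interpret H: comm_group "Hom_group A (Dom A f) (Cod A c)" using Hom_comm_group O by simp
        let ?z = "Zero A (Dom A i) (Cod A c)"
        have zc: "?z \<in> Hom A (Dom A i) (Cod A c)" using G.one_closed by (simp add: Hom_group_def)
        have zz: "Add A ?z ?z = ?z" using G.l_one[of ?z] zc by (simp add: Hom_group_def)
        have "Add A (?z \<cdot> h) (?z \<cdot> h) = ?z \<cdot> h" using Comp_Add_left[OF h(1) zc zc] zz by simp
        then show ?thesis
          using H.l_cancel_one[of "?z \<cdot> h" "?z \<cdot> h"] Comp_Hom[OF h(1) zc]
          by (simp add: Hom_group_def)
      qed
      have "c \<cdot> x \<cdot> f = (c \<cdot> i) \<cdot> h" using Comp_assoc[OF h(1) ih] h by simp
      also have "\<dots> = Zero A (Dom A f) (Cod A c)"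
        using z WE_D[OF ic] by (simp add: weak_kernel_def)
      finally show "c \<cdot> x \<cdot> f = Zero A (Dom A f) (Cod A c)" .
    qed
    have "preenvelope A \<J> X c"
      unfolding preenvelope_def
    proof (intro conjI ballI impI)
      show "c \<in> \<J>" by (rule c)
      show "Dom A c = X" using i WE_D[OF ic] unfolding weak_kernel_def precover_def by simp_all
      fix f assume f: "f \<in> \<J>" "Dom A f = X"
      then have "f \<cdot> i = Zero A (Dom A i) (Cod A f)" using ortho i by (auto simp: precover_def)
      then show "\<exists>h \<in> Hom A (Cod A c) (Cod A f). f = h \<cdot> c"
        using f idJ i WE_D(2)[OF ic] unfolding weak_cokernel_def precover_def ideal_def
        by (metis subsetD)
    qed
    then show "\<exists>j. preenvelope A \<J> X j \<and> weak_deflation WE j"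
      using ic by (auto simp: weak_deflation_def)
  qed
  moreover have "Hom_special_precovering A WE \<I>" if sp: "Hom_special_preenveloping A WE \<J>"
    unfolding Hom_special_precovering_def
  proof
    fix X assume "X \<in> Obj A"
    then obtain k j where j: "preenvelope A \<J> X j" and kj: "(k, j) \<in> WE"
      using sp by (auto simp: Hom_special_preenveloping_def weak_deflation_def)
    have jh: "k \<in> Hom A (Dom A k) X" "j \<in> Hom A X (Cod A j)"
      using j WE_D[OF kj] unfolding weak_kernel_def preenvelope_def Hom_def by simp_all
    have k: "k \<in> \<I>"
      unfolding I left_perp_def
    proof (intro CollectI conjI ballI)
      show "k \<in> Arr A" using jh by (auto simp: Hom_def)
      fix f x assume f: "f \<in> \<J>" and x: "x \<in> Hom A (Cod A k) (Dom A f)"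
      have fh: "f \<in> Hom A (Dom A f) (Cod A f)" using f idJ unfolding ideal_def Hom_def by blast
      have x': "x \<in> Hom A X (Dom A f)" using x jh by (auto simp: Hom_def)
      have "f \<cdot> x \<in> \<J>" using f x idJ unfolding ideal_def Hom_def by (metis (lifting) mem_Collect_eq)
      moreover have "Dom A (f \<cdot> x) = X" "Cod A (f \<cdot> x) = Cod A f"
        using Comp_Hom[OF x' fh] by (simp_all add: Hom_def)
      ultimately obtain h where h: "h \<in> Hom A (Cod A j) (Cod A f)" "f \<cdot> x = h \<cdot> j"
        using j unfolding preenvelope_def by metis
      have O: "Dom A k \<in> Obj A" "Cod A j \<in> Obj A" "Cod A f \<in> Obj A"
        using jh fh Dom_Obj Cod_Obj by (auto simp: Hom_def)
      have z: "h \<cdot> Zero A (Dom A k) (Cod A j) = Zero A (Dom A k) (Cod A f)"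
      proof -
        interpret G: comm_group "Hom_group A (Dom A k) (Cod A j)" using Hom_comm_group O by simp
        interpret H: comm_group "Hom_group A (Dom A k) (Cod A f)" using Hom_comm_group O by simp
        let ?z = "Zero A (Dom A k) (Cod A j)"
        have zc: "?z \<in> Hom A (Dom A k) (Cod A j)" using G.one_closed by (simp add: Hom_group_def)
        have zz: "Add A ?z ?z = ?z" using G.l_one[of ?z] zc by (simp add: Hom_group_def)
        have "Add A (h \<cdot> ?z) (h \<cdot> ?z) = h \<cdot> ?z" using Comp_Add_right[OF zc zc h(1)] zz by simp
        then show ?thesis
          using H.l_cancel_one[of "h \<cdot> ?z" "h \<cdot> ?z"] Comp_Hom[OF zc h(1)]
          by (simp add: Hom_group_def)
      qed
      have "f \<cdot> x \<cdot> k = (f \<cdot> x) \<cdot> k" using Comp_assoc[OF jh(1) x' fh] by simp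
      also have "\<dots> = h \<cdot> j \<cdot> k" using Comp_assoc[OF jh h(1)] h by simp
      also have "\<dots> = Zero A (Dom A k) (Cod A f)"
        using z WE_D[OF kj] by (simp add: weak_kernel_def)
      finally show "f \<cdot> x \<cdot> k = Zero A (Dom A k) (Cod A f)" .
    qed
    have "precover A \<I> X k"
      unfolding precover_def
    proof (intro conjI ballI impI)
      show "k \<in> \<I>" by (rule k)
      show "Cod A k = X" using jh by (auto simp: Hom_def)
      fix f assume f: "f \<in> \<I>" "Cod A f = X"
      then have "j \<cdot> f = Zero A (Dom A f) (Cod A j)" using ortho j by (auto simp: preenvelope_def)
      then show "\<exists>h \<in> Hom A (Dom A f) (Dom A k). f = k \<cdot> h"
        using f idI j WE_D(1)[OF kj] unfolding weak_kernel_def preenvelope_def ideal_def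
        by (metis subsetD)
    qed
    then show "\<exists>i. precover A \<I> X i \<and> weak_inflation WE i"
      using kj by (auto simp: weak_inflation_def)
  qed
  ultimately show ?thesis by (auto simp: complete_ideal_torsion_pair_def)
qed (simp add: complete_ideal_torsion_pair_def)

end

end

theory Submission
  imports Defs "HOL-Algebra.Coset"
begin

text \<open>A pair \<open>(\<I>, \<J>)\<close> is a complete ideal torsion pair as soon as \<open>\<I>\<close> and \<open>\<J>\<close> are orthogonal,
  closed under composition on the outer side, and every object \<open>X\<close> is the middle term of a weak
  conflation \<open>(k, c)\<close> with \<open>k \<in> \<I>\<close> and \<open>c \<in> \<J>\<close>: a morphism \<open>g\<close> orthogonal to \<open>\<I>\<close> kills \<open>k\<close> and so
  factors through \<open>c\<close>, and dually. Given such conflations \<open>(k1, c1)\<close> at \<open>X\<close> and \<open>(k2, c2)\<close> at the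
  domain of \<open>k1\<close>, the composite \<open>k1 \<cdot> k2\<close> is a weak inflation in \<open>\<I>1 \<I>2\<close>; its weak cokernel \<open>c\<close>
  kills \<open>k1 \<cdot> k2\<close>, so \<open>c \<cdot> k1\<close> factors through \<open>c2 \<in> \<J>2\<close>, which exhibits \<open>c\<close> as a weak extension
  of \<open>c1 \<in> \<J>1\<close> by \<open>c \<cdot> k1 \<in> \<J>2\<close> along \<open>(k1, c1)\<close>. The second pair is dual.\<close>

section \<open>Morphisms with named objects, and the duality between the two perps\<close>

lemma Hom_Arr: "f \<in> Arr C \<Longrightarrow> f \<in> Hom C (Dom C f) (Cod C f)"
  by (simp add: Hom_def)

lemma HomD:
  assumes "f \<in> Hom C X Y"
  shows "f \<in> Arr C" "Dom C f = X" "Cod C f = Y"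
  using assms by (auto simp: Hom_def)

lemma (in category) Hom_Obj:
  assumes "f \<in> Hom C X Y"
  shows "X \<in> Obj C" "Y \<in> Obj C"
  using assms Dom_Obj Cod_Obj by (auto simp: Hom_def)

text \<open>The Galois connection between the two perps: both sides unfold to the same equations
  \<open>j \<cdot> x \<cdot> i = 0\<close>, quantified in a different order. It allows orthogonality
  to be proved on one side only.\<close>

lemma subset_left_perp_iff_subset_right_perp:
  assumes "\<I> \<subseteq> Arr A" "\<J> \<subseteq> Arr A"
  shows "\<I> \<subseteq> left_perp A \<J> \<longleftrightarrow> \<J> \<subseteq> right_perp A \<I>"
  using assms unfolding left_perp_def right_perp_def by blast

section \<open>Perps as ideals, via homomorphisms of Hom groups\<close>

context preadditive_category
begin

lemma carrier_Hom_group: "carrier (Hom_group A X Y) = Hom A X Y"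
  by (simp add: Hom_group_def)

lemma Hom_group_group:
  assumes "X \<in> Obj A" "Y \<in> Obj A"
  shows "group (Hom_group A X Y)"
  using Hom_comm_group[OF assms] by (rule comm_group.axioms)

text \<open>Biadditivity of composition is packaged as group homomorphisms, here and in the dual
  below, so that preservation of zero and the subgroup property of kernels come from general group
  theory.\<close>

lemma group_hom_precomp:
  assumes f: "f \<in> Hom A X Y" and Z: "Z \<in> Obj A"
  shows "group_hom (Hom_group A Y Z) (Hom_group A X Z) (\<lambda>g. g \<cdot> f)"
proof (intro group_hom.intro group_hom_axioms.intro Hom_group_group homI)
  show "X \<in> Obj A" "Y \<in> Obj A" "Z \<in> Obj A" "Z \<in> Obj A" using Hom_Obj[OF f] Z by simp_all
qed (simp_all add: Hom_group_def Comp_Hom[OF f] Comp_Add_left[OF f])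

lemma group_hom_postcomp:
  assumes g: "g \<in> Hom A Y Z" and X: "X \<in> Obj A"
  shows "group_hom (Hom_group A X Y) (Hom_group A X Z) (\<lambda>f. g \<cdot> f)"
proof (intro group_hom.intro group_hom_axioms.intro Hom_group_group homI)
  show "X \<in> Obj A" "Y \<in> Obj A" "X \<in> Obj A" "Z \<in> Obj A" using Hom_Obj[OF g] X by simp_all
qed (simp_all add: Hom_group_def Comp_Hom[OF _ g] Comp_Add_right[OF _ _ g])

lemma Zero_Comp:
  assumes "f \<in> Hom A X Y" "Z \<in> Obj A"
  shows "Zero A Y Z \<cdot> f = Zero A X Z"
  using group_hom.hom_one[OF group_hom_precomp[OF assms]] by (simp add: Hom_group_def)

lemma Comp_Zero:
  assumes "g \<in> Hom A Y Z" "X \<in> Obj A"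
  shows "g \<cdot> Zero A X Y = Zero A X Z"
  using group_hom.hom_one[OF group_hom_postcomp[OF assms]] by (simp add: Hom_group_def)

text \<open>This form exhibits each Hom-component of a right perp as an intersection of kernels of
  precomposition with the morphisms \<open>x \<cdot> f\<close>, hence as a subgroup.\<close>

lemma mem_right_perp_iff:
  assumes "j \<in> Hom A Y Z"
  shows "j \<in> right_perp A \<M> \<longleftrightarrow>
    (\<forall>f \<in> \<M>. \<forall>x \<in> Hom A (Cod A f) Y. j \<in> kernel (Hom_group A Y Z) (Hom_group A (Dom A f) Z) (\<lambda>j. j \<cdot> x \<cdot> f))"
  using assms by (auto simp: right_perp_def kernel_def Hom_group_def HomD[OF assms])

lemma ideal_right_perp:
  assumes M: "\<M> \<subseteq> Arr A"
  shows "ideal A (right_perp A \<M>)"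
  unfolding ideal_def
proof (intro conjI ballI impI)
  show "right_perp A \<M> \<subseteq> Arr A" by (auto simp: right_perp_def)
next
  fix Y Z assume O: "Y \<in> Obj A" "Z \<in> Obj A"
  let ?G = "Hom_group A Y Z"
  interpret G: comm_group ?G using Hom_comm_group O by simp
  define K where "K f x = kernel ?G (Hom_group A (Dom A f) Z) (\<lambda>j. j \<cdot> x \<cdot> f)" for f x
  have "subgroup (K f x) ?G" if "f \<in> \<M>" "x \<in> Hom A (Cod A f) Y" for f x
    unfolding K_def
    using that M O by (intro group_hom.subgroup_kernel group_hom_precomp Comp_Hom[OF Hom_Arr]) auto
  \<comment> \<open>The full carrier is inserted to keep the family nonempty when there is no pair
    \<open>(f, x)\<close>; the intersection is then all of \<open>Hom A Y Z\<close>, as it should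
    be.\<close>
  then have "subgroup (\<Inter> (insert (carrier ?G) ((\<lambda>(f, x). K f x) ` (SIGMA f:\<M>. Hom A (Cod A f) Y)))) ?G"
    by (intro G.subgroups_Inter) (auto intro: G.subgroup_self)
  also have "\<Inter> (insert (carrier ?G) ((\<lambda>(f, x). K f x) ` (SIGMA f:\<M>. Hom A (Cod A f) Y)))
      = right_perp A \<M> \<inter> Hom A Y Z"
    by (auto simp: K_def mem_right_perp_iff carrier_Hom_group)
  finally show "subgroup (right_perp A \<M> \<inter> Hom A Y Z) ?G" .
next
  fix j g assume j: "j \<in> right_perp A \<M>" and g: "g \<in> Arr A" "Cod A g = Dom A j"
  then have jh: "j \<in> Hom A (Dom A j) (Cod A j)" and gh: "g \<in> Hom A (Dom A g) (Dom A j)"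
    by (auto simp: right_perp_def Hom_def)
  \<comment> \<open>Precomposition with \<open>g\<close> only changes the connecting morphism from
    \<open>x\<close> to \<open>g \<cdot> x\<close>, over which the perp already quantifies.\<close>
  have "(j \<cdot> g) \<cdot> x \<cdot> f = Zero A (Dom A f) (Cod A j)"
    if f: "f \<in> \<M>" and x: "x \<in> Hom A (Cod A f) (Dom A g)" for f x
  proof -
    have fh: "f \<in> Hom A (Dom A f) (Cod A f)" using f M by (auto intro: Hom_Arr)
    have "(j \<cdot> g) \<cdot> x \<cdot> f = j \<cdot> (g \<cdot> x) \<cdot> f"
      using Comp_assoc[OF Comp_Hom[OF fh x] gh jh] Comp_assoc[OF fh x gh] by simp
    then show ?thesis using j f Comp_Hom[OF x gh] by (simp add: right_perp_def)
  qed
  then show "j \<cdot> g \<in> right_perp A \<M>"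
    using HomD[OF Comp_Hom[OF gh jh]] by (simp add: right_perp_def)
next
  fix j g assume j: "j \<in> right_perp A \<M>" and g: "g \<in> Arr A" "Cod A j = Dom A g"
  then have jh: "j \<in> Hom A (Dom A j) (Cod A j)" and gh: "g \<in> Hom A (Cod A j) (Cod A g)"
    by (auto simp: right_perp_def Hom_def)
  \<comment> \<open>On the outer side, \<open>g\<close> is composed with a morphism that is already
    zero.\<close>
  have "(g \<cdot> j) \<cdot> x \<cdot> f = Zero A (Dom A f) (Cod A g)"
    if f: "f \<in> \<M>" and x: "x \<in> Hom A (Cod A f) (Dom A j)" for f x
  proof -
    have fh: "f \<in> Hom A (Dom A f) (Cod A f)" using f M by (auto intro: Hom_Arr)
    have "(g \<cdot> j) \<cdot> x \<cdot> f = g \<cdot> j \<cdot> x \<cdot> f"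
      using Comp_assoc[OF Comp_Hom[OF fh x] jh gh] by simp
    then show ?thesis using j f x Comp_Zero[OF gh] Hom_Obj[OF fh] by (simp add: right_perp_def)
  qed
  then show "g \<cdot> j \<in> right_perp A \<M>"
    using HomD[OF Comp_Hom[OF jh gh]] by (simp add: right_perp_def)
qed

text \<open>The product is bracketed as \<open>(f \<cdot> x) \<cdot> i\<close> so that the map is
  postcomposition with a single morphism and \<open>group_hom_postcomp\<close> applies.
  Reassociating requires the members of \<open>\<M>\<close> to be arrows.\<close>

lemma mem_left_perp_iff:
  assumes "\<M> \<subseteq> Arr A" "i \<in> Hom A X Y"
  shows "i \<in> left_perp A \<M> \<longleftrightarrow>
    (\<forall>f \<in> \<M>. \<forall>x \<in> Hom A Y (Dom A f).
       i \<in> kernel (Hom_group A X Y) (Hom_group A X (Cod A f)) (\<lambda>i. (f \<cdot> x) \<cdot> i))"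
proof -
  have "(f \<cdot> x) \<cdot> i = f \<cdot> x \<cdot> i" if "f \<in> \<M>" "x \<in> Hom A Y (Dom A f)" for f x
    using Comp_assoc[OF assms(2) that(2) Hom_Arr] that assms(1) by blast
  then show ?thesis
    using assms(2) by (auto simp: left_perp_def kernel_def Hom_group_def HomD[OF assms(2)])
qed

lemma ideal_left_perp:
  assumes M: "\<M> \<subseteq> Arr A"
  shows "ideal A (left_perp A \<M>)"
  unfolding ideal_def
proof (intro conjI ballI impI)
  show "left_perp A \<M> \<subseteq> Arr A" by (auto simp: left_perp_def)
next
  fix X Y assume O: "X \<in> Obj A" "Y \<in> Obj A"
  let ?G = "Hom_group A X Y"
  interpret G: comm_group ?G using Hom_comm_group O by simp
  define K where "K f x = kernel ?G (Hom_group A X (Cod A f)) (\<lambda>i. (f \<cdot> x) \<cdot> i)" for f x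
  have "subgroup (K f x) ?G" if "f \<in> \<M>" "x \<in> Hom A Y (Dom A f)" for f x
    unfolding K_def
    using that M O by (intro group_hom.subgroup_kernel group_hom_postcomp Comp_Hom[OF _ Hom_Arr]) auto
  then have "subgroup (\<Inter> (insert (carrier ?G) ((\<lambda>(f, x). K f x) ` (SIGMA f:\<M>. Hom A Y (Dom A f))))) ?G"
    by (intro G.subgroups_Inter) (auto intro: G.subgroup_self)
  also have "\<Inter> (insert (carrier ?G) ((\<lambda>(f, x). K f x) ` (SIGMA f:\<M>. Hom A Y (Dom A f))))
      = left_perp A \<M> \<inter> Hom A X Y"
    by (auto simp: K_def mem_left_perp_iff[OF M] carrier_Hom_group)
  finally show "subgroup (left_perp A \<M> \<inter> Hom A X Y) ?G" .
next
  fix i g assume i: "i \<in> left_perp A \<M>" and g: "g \<in> Arr A" "Cod A g = Dom A i"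
  then have ih: "i \<in> Hom A (Dom A i) (Cod A i)" and gh: "g \<in> Hom A (Dom A g) (Dom A i)"
    by (auto simp: left_perp_def Hom_def)
  have "f \<cdot> x \<cdot> i \<cdot> g = Zero A (Dom A g) (Cod A f)"
    if f: "f \<in> \<M>" and x: "x \<in> Hom A (Cod A i) (Dom A f)" for f x
  proof -
    have fh: "f \<in> Hom A (Dom A f) (Cod A f)" using f M by (auto intro: Hom_Arr)
    have "f \<cdot> x \<cdot> i \<cdot> g = (f \<cdot> x \<cdot> i) \<cdot> g"
      using Comp_assoc[OF gh ih x] Comp_assoc[OF gh Comp_Hom[OF ih x] fh] by simp
    then show ?thesis using i f x Zero_Comp[OF gh] Hom_Obj[OF fh] by (simp add: left_perp_def)
  qed
  then show "i \<cdot> g \<in> left_perp A \<M>"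
    using HomD[OF Comp_Hom[OF gh ih]] by (simp add: left_perp_def)
next
  fix i g assume i: "i \<in> left_perp A \<M>" and g: "g \<in> Arr A" "Cod A i = Dom A g"
  then have ih: "i \<in> Hom A (Dom A i) (Cod A i)" and gh: "g \<in> Hom A (Cod A i) (Cod A g)"
    by (auto simp: left_perp_def Hom_def)
  have "f \<cdot> x \<cdot> g \<cdot> i = Zero A (Dom A i) (Cod A f)"
    if f: "f \<in> \<M>" and x: "x \<in> Hom A (Cod A g) (Dom A f)" for f x
  proof -
    \<comment> \<open>For the left perp it is postcomposition that is absorbed into the connecting
      morphism, now \<open>x \<cdot> g\<close>.\<close>
    have "f \<cdot> (x \<cdot> g) \<cdot> i = Zero A (Dom A i) (Cod A f)"
      using i f Comp_Hom[OF gh x] unfolding left_perp_def by blast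
    then show ?thesis using Comp_assoc[OF ih gh x] by simp
  qed
  then show "g \<cdot> i \<in> left_perp A \<M>"
    using HomD[OF Comp_Hom[OF ih gh]] by (simp add: left_perp_def)
qed

section \<open>Closure and annihilation properties of ideals, perps and products\<close>

lemma ideal_precomp:
  assumes "ideal A \<I>" "i \<in> \<I>" "i \<in> Hom A Y Z" "f \<in> Hom A X Y"
  shows "i \<cdot> f \<in> \<I>"
  using assms(1,2) HomD[OF assms(3)] HomD[OF assms(4)] unfolding ideal_def by simp

lemma ideal_postcomp:
  assumes "ideal A \<I>" "i \<in> \<I>" "i \<in> Hom A X Y" "f \<in> Hom A Y Z"
  shows "f \<cdot> i \<in> \<I>"
  using assms(1,2) HomD[OF assms(3)] HomD[OF assms(4)] unfolding ideal_def by simp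

text \<open>The special case of the perp condition in which the connecting morphism is an
  identity.\<close>

lemma mem_right_perp_Comp:
  assumes g: "g \<in> right_perp A \<M>" "g \<in> Hom A Y Z" and f: "f \<in> \<M>" "f \<in> Hom A X Y"
  shows "g \<cdot> f = Zero A X Z"
proof -
  have "Ident A Y \<in> Hom A (Cod A f) (Dom A g)"
    using Ident_Hom Hom_Obj[OF f(2)] HomD[OF f(2)] HomD[OF g(2)] by simp
  then have "g \<cdot> Ident A Y \<cdot> f = Zero A (Dom A f) (Cod A g)"
    using g(1) f(1) unfolding right_perp_def by blast
  then show ?thesis using Comp_Ident_left[OF f(2)] HomD[OF f(2)] HomD[OF g(2)] by simp
qed

lemma mem_left_perp_Comp:
  assumes f: "f \<in> left_perp A \<M>" "f \<in> Hom A X Y" and g: "g \<in> \<M>" "g \<in> Hom A Y Z"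
  shows "g \<cdot> f = Zero A X Z"
proof -
  have "Ident A Y \<in> Hom A (Cod A f) (Dom A g)"
    using Ident_Hom Hom_Obj[OF f(2)] HomD[OF f(2)] HomD[OF g(2)] by simp
  then have "g \<cdot> Ident A Y \<cdot> f = Zero A (Dom A f) (Cod A g)"
    using f(1) g(1) unfolding left_perp_def by blast
  then show ?thesis using Comp_Ident_left[OF f(2)] HomD[OF f(2)] HomD[OF g(2)] by simp
qed

lemma ideal_torsion_pair_Comp:
  assumes "ideal_torsion_pair A \<I> \<J>" "i \<in> \<I>" "j \<in> \<J>" "i \<in> Hom A X Y" "j \<in> Hom A Y Z"
  shows "j \<cdot> i = Zero A X Z"
proof (rule mem_right_perp_Comp)
  show "j \<in> right_perp A \<I>" using assms(1,3) unfolding ideal_torsion_pair_def by blast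
qed (use assms in simp_all)

lemma ideal_torsion_pair_ideals:
  assumes "ideal_torsion_pair A \<I> \<J>"
  shows "ideal A \<I>" "ideal A \<J>"
  using assms unfolding ideal_torsion_pair_def by blast+

lemma ideal_ArrD: "ideal A \<I> \<Longrightarrow> \<I> \<subseteq> Arr A"
  by (simp add: ideal_def)

lemma ideal_productE:
  assumes "e \<in> ideal_product A \<I> \<J>" "\<I> \<subseteq> Arr A" "\<J> \<subseteq> Arr A" "e \<in> Hom A X Z"
  obtains i j Y where "e = i \<cdot> j" "i \<in> \<I>" "j \<in> \<J>" "i \<in> Hom A Y Z" "j \<in> Hom A X Y"
proof -
  obtain i j where ij: "e = i \<cdot> j" "i \<in> \<I>" "j \<in> \<J>" "Dom A i = Cod A j"
    using assms by (auto simp: ideal_product_def)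
  have h: "i \<in> Hom A (Cod A j) (Cod A i)" "j \<in> Hom A (Dom A j) (Cod A j)"
    using ij assms by (auto simp: Hom_def)
  have "Dom A j = X" "Cod A i = Z"
    using HomD[OF Comp_Hom[OF h(2,1)]] HomD[OF assms(4)] ij(1) by auto
  then show thesis using that ij h by blast
qed

lemma ideal_product_subset_Arr:
  assumes "\<I> \<subseteq> Arr A" "\<J> \<subseteq> Arr A"
  shows "ideal_product A \<I> \<J> \<subseteq> Arr A"
proof
  fix e assume "e \<in> ideal_product A \<I> \<J>"
  then obtain i j where "e = i \<cdot> j" "i \<in> \<I>" "j \<in> \<J>" "Dom A i = Cod A j"
    by (auto simp: ideal_product_def)
  then show "e \<in> Arr A"
    using assms Comp_Hom[of j "Dom A j" "Cod A j" i "Cod A i"] by (auto simp: Hom_def)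
qed

lemma ideal_productI:
  assumes "i \<in> \<I>" "j \<in> \<J>" "i \<in> Hom A Y Z" "j \<in> Hom A X Y"
  shows "i \<cdot> j \<in> ideal_product A \<I> \<J>"
  unfolding ideal_product_def using assms(1,2) HomD(2)[OF assms(3)] HomD(3)[OF assms(4)]
  by (intro CollectI exI[of _ i] exI[of _ j]) simp

text \<open>The right factor absorbs \<open>f\<close>, so ideality is asked of \<open>\<J>\<close>;
  in the dual lemma the left factor absorbs it.\<close>

lemma ideal_product_precomp:
  assumes I: "\<I> \<subseteq> Arr A" and J: "ideal A \<J>" and e: "e \<in> ideal_product A \<I> \<J>"
    "e \<in> Hom A Y Z" and f: "f \<in> Hom A X Y"
  shows "e \<cdot> f \<in> ideal_product A \<I> \<J>"
proof -
  obtain i j W where ij: "e = i \<cdot> j" "i \<in> \<I>" "j \<in> \<J>" "i \<in> Hom A W Z" "j \<in> Hom A Y W"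
    using ideal_productE[OF e(1) I ideal_ArrD[OF J] e(2)] .
  have "i \<cdot> j \<cdot> f \<in> ideal_product A \<I> \<J>"
    by (rule ideal_productI[OF ij(2) ideal_precomp[OF J ij(3,5) f] ij(4) Comp_Hom[OF f ij(5)]])
  then show ?thesis using Comp_assoc[OF f ij(5,4)] ij(1) by simp
qed

lemma ideal_product_postcomp:
  assumes I: "ideal A \<I>" and J: "\<J> \<subseteq> Arr A" and e: "e \<in> ideal_product A \<I> \<J>"
    "e \<in> Hom A X Y" and f: "f \<in> Hom A Y Z"
  shows "f \<cdot> e \<in> ideal_product A \<I> \<J>"
proof -
  obtain i j W where ij: "e = i \<cdot> j" "i \<in> \<I>" "j \<in> \<J>" "i \<in> Hom A W Y" "j \<in> Hom A X W"
    using ideal_productE[OF e(1) ideal_ArrD[OF I] J e(2)] .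
  have "(f \<cdot> i) \<cdot> j \<in> ideal_product A \<I> \<J>"
    by (rule ideal_productI[OF ideal_postcomp[OF I ij(2,4) f] ij(3) Comp_Hom[OF ij(4) f] ij(5)])
  then show ?thesis using Comp_assoc[OF ij(5,4) f] ij(1) by simp
qed

end

section \<open>Weak conflations and the criterion for completeness\<close>

context weak_kc_category
begin

lemma WE_Hom:
  assumes "(k, c) \<in> WE"
  obtains X Y Z where "k \<in> Hom A X Y" "c \<in> Hom A Y Z" "c \<cdot> k = Zero A X Z"
  using WE_D[OF assms] that[of "Dom A k" "Cod A k" "Cod A c"]
  by (auto simp: weak_kernel_def Hom_def)

lemma WE_Comp:
  assumes "(k, c) \<in> WE" "k \<in> Hom A X Y" "c \<in> Hom A Y Z"
  shows "c \<cdot> k = Zero A X Z"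
  using WE_D[OF assms(1)] assms by (auto simp: weak_kernel_def Hom_def)

lemma WE_kernelE:
  assumes "(k, c) \<in> WE" "k \<in> Hom A X Y" "c \<in> Hom A Y Z" "f \<in> Hom A W Y" "c \<cdot> f = Zero A W Z"
  obtains h where "h \<in> Hom A W X" "f = k \<cdot> h"
proof -
  have "\<exists>h \<in> Hom A (Dom A f) (Dom A k). f = k \<cdot> h"
    using WE_D(1)[OF assms(1)] assms(2-) by (auto simp: weak_kernel_def Hom_def)
  then show thesis using that assms(2,4) by (auto simp: Hom_def)
qed

lemma WE_cokernelE:
  assumes "(k, c) \<in> WE" "k \<in> Hom A X Y" "c \<in> Hom A Y Z" "f \<in> Hom A Y W" "f \<cdot> k = Zero A X W"
  obtains h where "h \<in> Hom A Z W" "f = h \<cdot> c"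
proof -
  have "\<exists>h \<in> Hom A (Cod A c) (Cod A f). f = h \<cdot> c"
    using WE_D(2)[OF assms(1)] assms(2-) by (auto simp: weak_cokernel_def Hom_def)
  then show thesis using that assms(3,4) by (auto simp: Hom_def)
qed

text \<open>A Hom-special precover \<open>k\<close> comes with a weak conflation
  \<open>(k, c)\<close>. For \<open>f\<close> in \<open>\<I>\<close>, the morphism
  \<open>x \<cdot> f\<close> is in \<open>\<I>\<close> and ends at \<open>X\<close>, so it factors
  through \<open>k\<close>, which \<open>c\<close> kills; thus \<open>c\<close> lies in the right
  perp of \<open>\<I>\<close>.\<close>

lemma complete_ideal_torsion_pair_approximation:
  assumes tp: "complete_ideal_torsion_pair A WE \<I> \<J>" and X: "X \<in> Obj A"
  obtains k c T F where "(k, c) \<in> WE" "k \<in> \<I>" "c \<in> \<J>" "k \<in> Hom A T X" "c \<in> Hom A X F"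
proof -
  have id: "ideal A \<I>" and J: "\<J> = right_perp A \<I>"
    using tp unfolding complete_ideal_torsion_pair_def ideal_torsion_pair_def by blast+
  obtain k c where k: "precover A \<I> X k" and kc: "(k, c) \<in> WE"
    using tp X by (auto simp: complete_ideal_torsion_pair_def Hom_special_precovering_def
        weak_inflation_def)
  obtain T F where kh: "k \<in> Hom A T X" and ch: "c \<in> Hom A X F" and 0: "c \<cdot> k = Zero A T F"
    using WE_Hom[OF kc] k by (auto simp: precover_def Hom_def)
  have "c \<cdot> x \<cdot> f = Zero A (Dom A f) F" if f: "f \<in> \<I>" and x: "x \<in> Hom A (Cod A f) X" for f x
  proof -
    have fh: "f \<in> Hom A (Dom A f) (Cod A f)" using f id by (auto simp: ideal_def intro: Hom_Arr)
    obtain h where h: "h \<in> Hom A (Dom A f) T" "x \<cdot> f = k \<cdot> h"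
      using k ideal_postcomp[OF id f fh x] HomD[OF Comp_Hom[OF fh x]] HomD[OF kh]
      by (auto simp: precover_def)
    then show ?thesis
      using Comp_assoc[OF h(1) kh ch] 0 Zero_Comp[OF h(1)] Hom_Obj[OF ch] by simp
  qed
  then have "c \<in> \<J>" using HomD[OF ch] by (auto simp: J right_perp_def)
  then show thesis using that kc kh ch k by (auto simp: precover_def)
qed

text \<open>The criterion spares a direct check that products and sets of weak extensions are closed
  under addition: the approximations force both sets to be perps, and perps are ideals.\<close>

lemma complete_ideal_torsion_pairI:
  assumes I: "\<I> \<subseteq> Arr A" and J: "\<J> \<subseteq> Arr A"
    and pre: "\<And>i f X Y Z. \<lbrakk>i \<in> \<I>; i \<in> Hom A Y Z; f \<in> Hom A X Y\<rbrakk> \<Longrightarrow> i \<cdot> f \<in> \<I>"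
    and post: "\<And>j f X Y Z. \<lbrakk>j \<in> \<J>; j \<in> Hom A X Y; f \<in> Hom A Y Z\<rbrakk> \<Longrightarrow> f \<cdot> j \<in> \<J>"
    and perp: "\<J> \<subseteq> right_perp A \<I>"
    and approx: "\<And>X. X \<in> Obj A \<Longrightarrow>
      \<exists>k c T F. (k, c) \<in> WE \<and> k \<in> \<I> \<and> c \<in> \<J> \<and> k \<in> Hom A T X \<and> c \<in> Hom A X F"
  shows "complete_ideal_torsion_pair A WE \<I> \<J>"
proof -
  \<comment> \<open>Orthogonality to \<open>c\<close> makes \<open>f\<close> factor through its weak
    kernel \<open>k\<close>. This serves twice: for the inclusion of the left perp in
    \<open>\<I>\<close> and for the precover property.\<close>
  have fac: "\<exists>h \<in> Hom A W T. f = k \<cdot> h"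
    if kc: "(k, c) \<in> WE" "c \<in> \<J>" "k \<in> Hom A T X" "c \<in> Hom A X F"
      and f: "f \<in> left_perp A \<J>" "f \<in> Hom A W X" for k c T X F f W
    using WE_kernelE[OF kc(1,3,4) f(2) mem_left_perp_Comp[OF f kc(2,4)]] by blast
  have perp': "\<I> \<subseteq> left_perp A \<J>" using subset_left_perp_iff_subset_right_perp I J perp by blast
  have "left_perp A \<J> \<subseteq> \<I>"
  proof
    fix f assume f: "f \<in> left_perp A \<J>"
    then have fh: "f \<in> Hom A (Dom A f) (Cod A f)" by (auto simp: left_perp_def Hom_def)
    obtain k c T F where kc: "(k, c) \<in> WE" "k \<in> \<I>" "c \<in> \<J>" "k \<in> Hom A T (Cod A f)"
        "c \<in> Hom A (Cod A f) F"
      using approx Hom_Obj[OF fh] by blast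
    obtain h where "h \<in> Hom A (Dom A f) T" "f = k \<cdot> h" using fac[OF kc(1,3,4,5) f fh] by blast
    then show "f \<in> \<I>" using pre[OF kc(2,4)] by simp
  qed
  moreover have "right_perp A \<I> \<subseteq> \<J>"
  proof
    fix f assume f: "f \<in> right_perp A \<I>"
    then have fh: "f \<in> Hom A (Dom A f) (Cod A f)" by (auto simp: right_perp_def Hom_def)
    obtain k c T F where kc: "(k, c) \<in> WE" "k \<in> \<I>" "c \<in> \<J>" "k \<in> Hom A T (Dom A f)"
        "c \<in> Hom A (Dom A f) F"
      using approx Hom_Obj[OF fh] by blast
    obtain h where "h \<in> Hom A F (Cod A f)" "f = h \<cdot> c"
      using WE_cokernelE[OF kc(1,4,5) fh mem_right_perp_Comp[OF f fh kc(2,4)]] .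
    then show "f \<in> \<J>" using post[OF kc(3,5)] by simp
  qed
  ultimately have eq: "\<I> = left_perp A \<J>" "\<J> = right_perp A \<I>" using perp perp' by auto
  \<comment> \<open>Additivity of both sets is inherited here from the perps they equal.\<close>
  have "ideal A \<I>" "ideal A \<J>"
    by (subst eq, rule ideal_left_perp[OF J]) (subst eq, rule ideal_right_perp[OF I])
  then have "ideal_torsion_pair A \<I> \<J>" using eq unfolding ideal_torsion_pair_def by blast
  moreover have "\<exists>k. precover A \<I> X k \<and> weak_inflation WE k" if X: "X \<in> Obj A" for X
  proof -
    obtain k c T F where kc: "(k, c) \<in> WE" "k \<in> \<I>" "c \<in> \<J>" "k \<in> Hom A T X" "c \<in> Hom A X F"
      using approx[OF X] by blast
    \<comment> \<open>Since \<open>\<I>\<close> lies in the left perp of \<open>\<J>\<close>,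
      \<open>fac\<close> shows that the given \<open>k\<close> is itself a precover.\<close>
    have "\<exists>h \<in> Hom A (Dom A f) (Dom A k). f = k \<cdot> h" if f: "f \<in> \<I>" "Cod A f = X" for f
    proof -
      have "f \<in> Hom A (Dom A f) X" using Hom_Arr[of f A] f I by blast
      then show ?thesis
        unfolding HomD(2)[OF kc(4)] using fac[OF kc(1,3,4,5)] f(1) perp' by blast
    qed
    then have "precover A \<I> X k" using kc(2) HomD(3)[OF kc(4)] unfolding precover_def by blast
    then show ?thesis using kc(1) unfolding weak_inflation_def by blast
  qed
  ultimately show ?thesis
    by (simp add: complete_ideal_torsion_pair_def Hom_special_precovering_def)
qed

section \<open>Weak extensions: closure under composition and orthogonality to products\<close>

lemma ideal_diamondI:
  assumes "(k, c) \<in> WE" "k \<in> Hom A X Y" "c \<in> Hom A Y Z" "e2 \<in> Hom A V Y" "e1 \<in> Hom A Y W"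
    and "e1 \<cdot> k \<in> \<I>" "c \<cdot> e2 \<in> \<J>"
  shows "e1 \<cdot> e2 \<in> ideal_diamond A WE \<I> \<J>"
proof -
  have "is_weak_extension A WE (e1 \<cdot> e2) (e1 \<cdot> k) (c \<cdot> e2)"
    unfolding is_weak_extension_def
    using HomD[OF Comp_Hom[OF assms(4,5)]] HomD(3)[OF assms(2)] assms(1,4,5) by metis
  then show ?thesis using assms(6,7) unfolding ideal_diamond_def by blast
qed

lemma ideal_diamondE:
  assumes "e \<in> ideal_diamond A WE \<I> \<J>" "e \<in> Hom A V W"
  obtains k c X Y Z e1 e2 where "(k, c) \<in> WE" "k \<in> Hom A X Y" "c \<in> Hom A Y Z"
    "e2 \<in> Hom A V Y" "e1 \<in> Hom A Y W" "e = e1 \<cdot> e2" "e1 \<cdot> k \<in> \<I>" "c \<cdot> e2 \<in> \<J>"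
proof -
  obtain k c e1 e2 where e: "(k, c) \<in> WE" "e2 \<in> Hom A V (Cod A k)" "e1 \<in> Hom A (Cod A k) W"
      "e = e1 \<cdot> e2" "e1 \<cdot> k \<in> \<I>" "c \<cdot> e2 \<in> \<J>"
    using assms HomD[OF assms(2)] by (auto simp: ideal_diamond_def is_weak_extension_def)
  obtain X Y Z where "k \<in> Hom A X Y" "c \<in> Hom A Y Z" using WE_Hom[OF e(1)] by blast
  then show thesis using that e by (auto simp: Hom_def)
qed

lemma ideal_diamond_subset_Arr: "ideal_diamond A WE \<I> \<J> \<subseteq> Arr A"
  by (auto simp: ideal_diamond_def is_weak_extension_def)

text \<open>The weak conflation and \<open>e1\<close> stay fixed while \<open>e2\<close> absorbs
  \<open>f\<close>; only the component \<open>c \<cdot> e2\<close> in \<open>\<J>\<close> changes.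
  In the dual lemma \<open>e1\<close> absorbs \<open>f\<close> and the component in
  \<open>\<I>\<close> changes.\<close>

lemma ideal_diamond_precomp:
  assumes J: "ideal A \<J>" and e: "e \<in> ideal_diamond A WE \<I> \<J>" "e \<in> Hom A V W"
    and f: "f \<in> Hom A U V"
  shows "e \<cdot> f \<in> ideal_diamond A WE \<I> \<J>"
  using e
proof (rule ideal_diamondE)
  fix k c X Y Z e1 e2
  assume kc: "(k, c) \<in> WE" "k \<in> Hom A X Y" "c \<in> Hom A Y Z" and e2: "e2 \<in> Hom A V Y"
    and e1: "e1 \<in> Hom A Y W" and eq: "e = e1 \<cdot> e2" and I: "e1 \<cdot> k \<in> \<I>" and "c \<cdot> e2 \<in> \<J>"
  then have "c \<cdot> e2 \<cdot> f \<in> \<J>"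
    using ideal_precomp[OF J _ Comp_Hom[OF e2 kc(3)] f] Comp_assoc[OF f e2 kc(3)] by simp
  then show ?thesis
    using ideal_diamondI[OF kc Comp_Hom[OF f e2] e1 I] Comp_assoc[OF f e2 e1] eq by simp
qed

lemma ideal_diamond_postcomp:
  assumes I: "ideal A \<I>" and e: "e \<in> ideal_diamond A WE \<I> \<J>" "e \<in> Hom A U V"
    and f: "f \<in> Hom A V W"
  shows "f \<cdot> e \<in> ideal_diamond A WE \<I> \<J>"
  using e
proof (rule ideal_diamondE)
  fix k c X Y Z e1 e2
  assume kc: "(k, c) \<in> WE" "k \<in> Hom A X Y" "c \<in> Hom A Y Z" and e2: "e2 \<in> Hom A U Y"
    and e1: "e1 \<in> Hom A Y V" and eq: "e = e1 \<cdot> e2" and "e1 \<cdot> k \<in> \<I>" and J: "c \<cdot> e2 \<in> \<J>"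
  then have "(f \<cdot> e1) \<cdot> k \<in> \<I>"
    using ideal_postcomp[OF I _ Comp_Hom[OF kc(2) e1] f] Comp_assoc[OF kc(2) e1 f] by simp
  then show ?thesis
    using ideal_diamondI[OF kc e2 Comp_Hom[OF e1 f] _ J] Comp_assoc[OF e2 e1 f] eq by simp
qed

text \<open>With \<open>e = e1 \<cdot> e2\<close> and \<open>f = a \<cdot> b\<close>, vanishing
  takes two stages. First \<open>c \<cdot> e2\<close> in \<open>\<J>1\<close> kills
  \<open>x \<cdot> a\<close> in \<open>\<I>1\<close>, so \<open>e2 \<cdot> x \<cdot> a\<close> lifts
  along the weak kernel as \<open>k \<cdot> h\<close>. Then \<open>e1 \<cdot> k\<close> in
  \<open>\<J>2\<close> kills \<open>h \<cdot> b\<close> in \<open>\<I>2\<close>.\<close>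

lemma ideal_diamond_perp_ideal_product:
  assumes t1: "ideal_torsion_pair A \<I>1 \<J>1" and t2: "ideal_torsion_pair A \<I>2 \<J>2"
  shows "ideal_diamond A WE \<J>2 \<J>1 \<subseteq> right_perp A (ideal_product A \<I>1 \<I>2)"
proof
  fix e assume e: "e \<in> ideal_diamond A WE \<J>2 \<J>1"
  have id: "ideal A \<I>1" "ideal A \<I>2" "ideal A \<J>1" "ideal A \<J>2"
    using t1 t2 by (auto dest: ideal_torsion_pair_ideals)
  then have Arr: "\<I>1 \<subseteq> Arr A" "\<I>2 \<subseteq> Arr A" by (auto simp: ideal_def)
  have eA: "e \<in> Arr A" using e ideal_diamond_subset_Arr by blast
  have "e \<cdot> x \<cdot> f = Zero A (Dom A f) (Cod A e)"
    if f: "f \<in> ideal_product A \<I>1 \<I>2" and x: "x \<in> Hom A (Cod A f) (Dom A e)" for f x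
  proof -
    have fh: "f \<in> Hom A (Dom A f) (Cod A f)"
      using f ideal_product_subset_Arr[OF Arr] by (auto intro: Hom_Arr)
    obtain a b M where ab: "f = a \<cdot> b" "a \<in> \<I>1" "b \<in> \<I>2"
        and a: "a \<in> Hom A M (Cod A f)" and b: "b \<in> Hom A (Dom A f) M"
      using ideal_productE[OF f Arr fh] .
    obtain k c X Y Z e1 e2 where kc: "(k, c) \<in> WE" and k: "k \<in> Hom A X Y" and c: "c \<in> Hom A Y Z"
        and e2: "e2 \<in> Hom A (Dom A e) Y" and e1: "e1 \<in> Hom A Y (Cod A e)"
        and eq: "e = e1 \<cdot> e2" and i: "e1 \<cdot> k \<in> \<J>2" and j: "c \<cdot> e2 \<in> \<J>1"
      using ideal_diamondE[OF e Hom_Arr[OF eA]] .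
    note xa = Comp_Hom[OF a x] and e2xa = Comp_Hom[OF Comp_Hom[OF a x] e2]
    have "(c \<cdot> e2) \<cdot> x \<cdot> a = Zero A M Z"
      by (rule ideal_torsion_pair_Comp[OF t1 ideal_postcomp[OF id(1) ab(2) a x] j xa Comp_Hom[OF e2 c]])
    then obtain h where h: "h \<in> Hom A M X" "e2 \<cdot> x \<cdot> a = k \<cdot> h"
      using WE_kernelE[OF kc k c e2xa] Comp_assoc[OF xa e2 c] by auto
    have "e \<cdot> x \<cdot> f = e1 \<cdot> (e2 \<cdot> x \<cdot> a) \<cdot> b"
      using Comp_assoc[OF b a x] Comp_assoc[OF b xa e2] Comp_assoc[OF Comp_Hom[OF b xa] e2 e1]
      by (simp add: eq ab(1))
    also have "\<dots> = (e1 \<cdot> k) \<cdot> h \<cdot> b"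
      using Comp_assoc[OF b h(1) k] Comp_assoc[OF Comp_Hom[OF b h(1)] k e1] h(2) by simp
    also have "\<dots> = Zero A (Dom A f) (Cod A e)"
      by (rule ideal_torsion_pair_Comp[OF t2 ideal_postcomp[OF id(2) ab(3) b h(1)] i
            Comp_Hom[OF b h(1)] Comp_Hom[OF k e1]])
    finally show ?thesis .
  qed
  then show "e \<in> right_perp A (ideal_product A \<I>1 \<I>2)" using eA by (simp add: right_perp_def)
qed

text \<open>Dual two-stage argument through the weak cokernel: \<open>b \<cdot> x\<close> in
  \<open>\<J>1\<close> kills \<open>e1 \<cdot> k\<close> in \<open>\<I>1\<close>, so
  \<open>(b \<cdot> x) \<cdot> e1\<close> descends to \<open>h \<cdot> c\<close>, and
  \<open>a \<cdot> h\<close> in \<open>\<J>2\<close> kills \<open>c \<cdot> e2\<close> in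
  \<open>\<I>2\<close>.\<close>

lemma ideal_product_perp_ideal_diamond:
  assumes t1: "ideal_torsion_pair A \<I>1 \<J>1" and t2: "ideal_torsion_pair A \<I>2 \<J>2"
  shows "ideal_product A \<J>2 \<J>1 \<subseteq> right_perp A (ideal_diamond A WE \<I>1 \<I>2)"
proof
  fix f assume f: "f \<in> ideal_product A \<J>2 \<J>1"
  have id: "ideal A \<I>1" "ideal A \<I>2" "ideal A \<J>1" "ideal A \<J>2"
    using t1 t2 by (auto dest: ideal_torsion_pair_ideals)
  then have Arr: "\<J>2 \<subseteq> Arr A" "\<J>1 \<subseteq> Arr A" by (auto simp: ideal_def)
  have fA: "f \<in> Arr A" using f ideal_product_subset_Arr[OF Arr] by blast
  obtain a b M where ab: "f = a \<cdot> b" "a \<in> \<J>2" "b \<in> \<J>1"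
      and a: "a \<in> Hom A M (Cod A f)" and b: "b \<in> Hom A (Dom A f) M"
    using ideal_productE[OF f Arr Hom_Arr[OF fA]] .
  have "f \<cdot> x \<cdot> e = Zero A (Dom A e) (Cod A f)"
    if e: "e \<in> ideal_diamond A WE \<I>1 \<I>2" and x: "x \<in> Hom A (Cod A e) (Dom A f)" for e x
  proof -
    have eh: "e \<in> Hom A (Dom A e) (Cod A e)"
      using e ideal_diamond_subset_Arr by (auto intro: Hom_Arr)
    obtain k c X Y Z e1 e2 where kc: "(k, c) \<in> WE" and k: "k \<in> Hom A X Y" and c: "c \<in> Hom A Y Z"
        and e2: "e2 \<in> Hom A (Dom A e) Y" and e1: "e1 \<in> Hom A Y (Cod A e)"
        and eq: "e = e1 \<cdot> e2" and i: "e1 \<cdot> k \<in> \<I>1" and j: "c \<cdot> e2 \<in> \<I>2"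
      using ideal_diamondE[OF e eh] .
    note bx = Comp_Hom[OF x b] and bxe1 = Comp_Hom[OF e1 Comp_Hom[OF x b]]
    have "(b \<cdot> x) \<cdot> e1 \<cdot> k = Zero A X M"
      by (rule ideal_torsion_pair_Comp[OF t1 i ideal_precomp[OF id(3) ab(3) b x]
            Comp_Hom[OF k e1] bx])
    then obtain h where h: "h \<in> Hom A Z M" "(b \<cdot> x) \<cdot> e1 = h \<cdot> c"
      using WE_cokernelE[OF kc k c bxe1] Comp_assoc[OF k e1 bx] by auto
    have "f \<cdot> x \<cdot> e = a \<cdot> ((b \<cdot> x) \<cdot> e1) \<cdot> e2"
      using Comp_assoc[OF Comp_Hom[OF eh x] b a] Comp_assoc[OF eh x b] Comp_assoc[OF e2 e1 bx]
      by (simp add: eq ab(1))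
    also have "\<dots> = (a \<cdot> h) \<cdot> c \<cdot> e2"
      using Comp_assoc[OF e2 c h(1)] Comp_assoc[OF Comp_Hom[OF e2 c] h(1) a] h(2) by simp
    also have "\<dots> = Zero A (Dom A e) (Cod A f)"
      by (rule ideal_torsion_pair_Comp[OF t2 j ideal_precomp[OF id(4) ab(2) a h(1)]
            Comp_Hom[OF e2 c] Comp_Hom[OF h(1) a]])
    finally show ?thesis .
  qed
  then show "f \<in> right_perp A (ideal_diamond A WE \<I>1 \<I>2)" using fA by (simp add: right_perp_def)
qed

end

section \<open>Approximations for the two composite pairs\<close>

context weak_exact_category
begin

lemma complete_product_diamond:
  assumes t1: "complete_ideal_torsion_pair A WE \<I>1 \<J>1"
    and t2: "complete_ideal_torsion_pair A WE \<I>2 \<J>2"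
  shows "complete_ideal_torsion_pair A WE (ideal_product A \<I>1 \<I>2) (ideal_diamond A WE \<J>2 \<J>1)"
proof -
  have tp: "ideal_torsion_pair A \<I>1 \<J>1" "ideal_torsion_pair A \<I>2 \<J>2"
    using t1 t2 by (auto simp: complete_ideal_torsion_pair_def)
  note id = ideal_torsion_pair_ideals[OF tp(2)]
  have Arr: "\<I>1 \<subseteq> Arr A" "\<I>2 \<subseteq> Arr A"
    using ideal_torsion_pair_ideals(1)[OF tp(1)] id by (simp_all add: ideal_ArrD)
  show ?thesis
  proof (rule complete_ideal_torsion_pairI)
    fix X assume X: "X \<in> Obj A"
    obtain k1 c1 T1 F1 where 1: "(k1, c1) \<in> WE" "k1 \<in> \<I>1" "c1 \<in> \<J>1" "k1 \<in> Hom A T1 X" "c1 \<in> Hom A X F1"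
      using complete_ideal_torsion_pair_approximation[OF t1 X] .
    have T1: "T1 \<in> Obj A" using Hom_Obj[OF 1(4)] by simp
    obtain k2 c2 T2 F2 where 2: "(k2, c2) \<in> WE" "k2 \<in> \<I>2" "c2 \<in> \<J>2" "k2 \<in> Hom A T2 T1" "c2 \<in> Hom A T1 F2"
      using complete_ideal_torsion_pair_approximation[OF t2 T1] .
    have kh: "k1 \<cdot> k2 \<in> Hom A T2 X" using Comp_Hom[OF 2(4) 1(4)] .
    \<comment> \<open>Closure of weak inflations under composition supplies
      \<open>c\<close>.\<close>
    obtain c where kc: "(k1 \<cdot> k2, c) \<in> WE"
      using weak_inflation_Comp[of k2 k1] 1 2 by (auto simp: weak_inflation_def Hom_def)
    obtain F where c: "c \<in> Hom A X F" using WE_Hom[OF kc] HomD(3)[OF kh] HomD(3) by metis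
    have "(c \<cdot> k1) \<cdot> k2 = Zero A T2 F"
      using WE_Comp[OF kc kh c] Comp_assoc[OF 2(4) 1(4) c] by simp
    then obtain h where "h \<in> Hom A F2 F" "c \<cdot> k1 = h \<cdot> c2"
      using WE_cokernelE[OF 2(1,4,5) Comp_Hom[OF 1(4) c]] by blast
    then have "c \<cdot> k1 \<in> \<J>2" using ideal_postcomp[OF id(2) 2(3,5)] by simp
    \<comment> \<open>The weak extension along \<open>(k1, c1)\<close> takes \<open>e2\<close> to be
      the identity of \<open>X\<close> and \<open>e1 = c\<close>, so its components are
      \<open>c \<cdot> k1\<close> and \<open>c1\<close>.\<close>
    then have "c \<cdot> Ident A X \<in> ideal_diamond A WE \<J>2 \<J>1"
      using ideal_diamondI[OF 1(1,4,5) Ident_Hom[OF X] c] 1(3) Comp_Ident_right[OF 1(5)] by simp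
    then have "c \<in> ideal_diamond A WE \<J>2 \<J>1" using Comp_Ident_right[OF c] by simp
    then show "\<exists>k c T F. (k, c) \<in> WE \<and> k \<in> ideal_product A \<I>1 \<I>2 \<and> c \<in> ideal_diamond A WE \<J>2 \<J>1
        \<and> k \<in> Hom A T X \<and> c \<in> Hom A X F"
      using kc kh c ideal_productI[OF 1(2) 2(2) 1(4) 2(4)] by blast
  next
    show "i \<cdot> f \<in> ideal_product A \<I>1 \<I>2"
      if "i \<in> ideal_product A \<I>1 \<I>2" "i \<in> Hom A Y Z" "f \<in> Hom A X Y" for i f X Y Z
      using ideal_product_precomp[OF Arr(1) id(1) that] .
    show "f \<cdot> j \<in> ideal_diamond A WE \<J>2 \<J>1"
      if "j \<in> ideal_diamond A WE \<J>2 \<J>1" "j \<in> Hom A X Y" "f \<in> Hom A Y Z" for j f X Y Z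
      using ideal_diamond_postcomp[OF id(2) that] .
  qed (rule ideal_product_subset_Arr[OF Arr] ideal_diamond_subset_Arr
      ideal_diamond_perp_ideal_product[OF tp])+
qed

text \<open>Here the second approximation is taken at \<open>F1\<close>, the codomain of
  \<open>c1\<close>, and \<open>k\<close> comes from closure of weak deflations under composition.
  As \<open>c2\<close> kills \<open>c1 \<cdot> k\<close>, the latter factors through
  \<open>k2\<close> and lies in \<open>\<I>2\<close>, so \<open>k\<close> is a weak extension of
  \<open>c1 \<cdot> k\<close> by \<open>k1\<close>.\<close>

lemma complete_diamond_product:
  assumes t1: "complete_ideal_torsion_pair A WE \<I>1 \<J>1"
    and t2: "complete_ideal_torsion_pair A WE \<I>2 \<J>2"
  shows "complete_ideal_torsion_pair A WE (ideal_diamond A WE \<I>1 \<I>2) (ideal_product A \<J>2 \<J>1)"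
proof -
  have tp: "ideal_torsion_pair A \<I>1 \<J>1" "ideal_torsion_pair A \<I>2 \<J>2"
    using t1 t2 by (auto simp: complete_ideal_torsion_pair_def)
  note id = ideal_torsion_pair_ideals[OF tp(2)]
  have Arr: "\<J>2 \<subseteq> Arr A" "\<J>1 \<subseteq> Arr A"
    using ideal_torsion_pair_ideals(2)[OF tp(1)] id by (simp_all add: ideal_ArrD)
  show ?thesis
  proof (rule complete_ideal_torsion_pairI)
    fix X assume X: "X \<in> Obj A"
    obtain k1 c1 T1 F1 where 1: "(k1, c1) \<in> WE" "k1 \<in> \<I>1" "c1 \<in> \<J>1" "k1 \<in> Hom A T1 X" "c1 \<in> Hom A X F1"
      using complete_ideal_torsion_pair_approximation[OF t1 X] .
    have F1: "F1 \<in> Obj A" using Hom_Obj[OF 1(5)] by simp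
    obtain k2 c2 T2 F2 where 2: "(k2, c2) \<in> WE" "k2 \<in> \<I>2" "c2 \<in> \<J>2" "k2 \<in> Hom A T2 F1" "c2 \<in> Hom A F1 F2"
      using complete_ideal_torsion_pair_approximation[OF t2 F1] .
    have ch: "c2 \<cdot> c1 \<in> Hom A X F2" using Comp_Hom[OF 1(5) 2(5)] .
    obtain k where kc: "(k, c2 \<cdot> c1) \<in> WE"
      using weak_deflation_Comp[of c1 c2] 1 2 by (auto simp: weak_deflation_def Hom_def)
    obtain T where k: "k \<in> Hom A T X" using WE_Hom[OF kc] HomD(2)[OF ch] HomD(2) by metis
    have "c2 \<cdot> c1 \<cdot> k = Zero A T F2"
      using WE_Comp[OF kc k ch] Comp_assoc[OF k 1(5) 2(5)] by simp
    then obtain h where "h \<in> Hom A T T2" "c1 \<cdot> k = k2 \<cdot> h"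
      using WE_kernelE[OF 2(1,4,5) Comp_Hom[OF k 1(5)]] by blast
    then have "c1 \<cdot> k \<in> \<I>2" using ideal_precomp[OF id(1) 2(2,4)] by simp
    \<comment> \<open>Now \<open>e1\<close> is the identity of \<open>X\<close> and
      \<open>e2 = k\<close>, again along \<open>(k1, c1)\<close>.\<close>
    then have "Ident A X \<cdot> k \<in> ideal_diamond A WE \<I>1 \<I>2"
      using ideal_diamondI[OF 1(1,4,5) k Ident_Hom[OF X]] 1(2) Comp_Ident_left[OF 1(4)] by simp
    then have "k \<in> ideal_diamond A WE \<I>1 \<I>2" using Comp_Ident_left[OF k] by simp
    then show "\<exists>k c T F. (k, c) \<in> WE \<and> k \<in> ideal_diamond A WE \<I>1 \<I>2 \<and> c \<in> ideal_product A \<J>2 \<J>1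
        \<and> k \<in> Hom A T X \<and> c \<in> Hom A X F"
      using kc k ch ideal_productI[OF 2(3) 1(3) 2(5) 1(5)] by blast
  next
    show "i \<cdot> f \<in> ideal_diamond A WE \<I>1 \<I>2"
      if "i \<in> ideal_diamond A WE \<I>1 \<I>2" "i \<in> Hom A Y Z" "f \<in> Hom A X Y" for i f X Y Z
      using ideal_diamond_precomp[OF id(1) that] .
    show "f \<cdot> j \<in> ideal_product A \<J>2 \<J>1"
      if "j \<in> ideal_product A \<J>2 \<J>1" "j \<in> Hom A X Y" "f \<in> Hom A Y Z" for j f X Y Z
      using ideal_product_postcomp[OF id(2) Arr(2) that] .
  qed (rule ideal_product_subset_Arr[OF Arr] ideal_diamond_subset_Arr
      ideal_product_perp_ideal_diamond[OF tp])+
qed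

end

theorem theorem36:
  fixes A :: "('o, 'm) preadd_cat"
    and WE :: "('m \<times> 'm) set"
    and \<I>1 \<J>1 \<I>2 \<J>2 :: "'m set"
  assumes "weak_exact_category A WE"
    and "complete_ideal_torsion_pair A WE \<I>1 \<J>1"
    and "complete_ideal_torsion_pair A WE \<I>2 \<J>2"
  shows "complete_ideal_torsion_pair A WE (ideal_product A \<I>1 \<I>2) (ideal_diamond A WE \<J>2 \<J>1)
       \<and> complete_ideal_torsion_pair A WE (ideal_diamond A WE \<I>1 \<I>2) (ideal_product A \<J>2 \<J>1)"
  using weak_exact_category.complete_product_diamond[OF assms]
    weak_exact_category.complete_diamond_product[OF assms] by simp

end
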